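(* Let $G$ and $H$ be topological groups and let $\Gamma<G\times H$ be a discrete subgroup that maps injectively to $G$ and densely to $H$ under the projections. Let $W\subseteq H$ be a compact symmetric identity neighborhood and let $\Lambda=\pi_G((G\times W)\cap\Gamma)$. Then for all compact subsets $I,K\subseteq H$ there exist finite sets $E,F\subseteq G$ such that for all subsets $\Pi\subseteq G$, $$\Lambda F\Pi\cap E\Lambda\Pi\supseteq\pi_G\big(\Gamma(\Pi\times K)\cap(G\times I)\big).$$
   Context: $\pi_G\colon G\times H\to G$ is the projection. Products of subsets of a group are elementwise products, and $\Gamma(\Pi\times K)$ is the product in $G\times H$. *)

theory Defs
  imports "HOL-Analysis.Analysis" "HOL-Algebra.Algebra"
begin

text \<open>No separation axiom is imposed, so compactness (\<^const>\<open>compactin\<close>) is the bare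
  open-cover property.\<close>

locale topological_group = group G for G :: "('a, 'm) monoid_scheme" (structure)
  and T :: "'a topology" +
  assumes topspace_eq_carrier: "topspace T = carrier G"
    and continuous_mult: "continuous_map (prod_topology T T) T (\<lambda>(x, y). x \<otimes> y)"
    and continuous_inv: "continuous_map T T (\<lambda>x. inv x)"

definition discrete_subgroup ::
    "'a set \<Rightarrow> ('a, 'm) monoid_scheme \<Rightarrow> 'a topology \<Rightarrow> bool" where
  "discrete_subgroup S G T \<longleftrightarrow> subgroup S G \<and> subtopology T S = discrete_topology S"

end

theory Submission
  imports Defs
begin

text \<open>Suppose that \<open>(g, h) \<in> \<Gamma>\<close>, \<open>p \<in> P\<close> and \<open>k \<in> K\<close> satisfy \<open>h k \<in> I\<close>. Then \<open>h\<close> lies in the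
  compact set \<open>I K\<inverse>\<close>, whatever \<open>P\<close> is. Since \<open>\<Gamma>\<close> projects densely to \<open>H\<close>, finitely many right
  translates \<open>W d\<close> with \<open>(f, d) \<in> \<Gamma>\<close> cover this set (\<open>compactin_covered_by_translates\<close>). If
  \<open>h \<in> W d\<close>, then \<open>(g f\<inverse>, h d\<inverse>) \<in> \<Gamma>\<close> has its second coordinate in \<open>W\<close>, so that \<open>g \<in> \<Lambda> f\<close>. Hence
  \<open>g p \<in> \<Lambda> F P\<close>, where \<open>F\<close> collects the finitely many \<open>f\<close>
  (\<open>finite_right_translates_of_model_set\<close>).

  The inclusion in \<open>E \<Lambda> P\<close> is the same statement for the element \<open>(g\<inverse>, h\<inverse>)\<close>, whose second
  coordinate lies in \<open>K I\<inverse>\<close>. It gives a finite \<open>F'\<close> with \<open>g\<inverse> \<in> \<Lambda> F'\<close>, and because \<open>W\<close>, and hence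
  \<open>\<Lambda>\<close>, is symmetric, inversion turns this into \<open>g \<in> E \<Lambda>\<close> with \<open>E = F'\<inverse>\<close>.\<close>

lemma (in topological_group) continuous_map_mult_inv:
  "continuous_map (prod_topology T T) T (\<lambda>(x, y). x \<otimes> inv y)"
proof -
  have "continuous_map (prod_topology T T) (prod_topology T T) (\<lambda>z. (fst z, inv (snd z)))"
    unfolding continuous_map_paired
    using continuous_map_compose[OF continuous_map_snd continuous_inv]
    by (simp add: continuous_map_fst o_def)
  from continuous_map_compose[OF this continuous_mult] show ?thesis
    by (simp add: o_def case_prod_unfold)
qed

lemma (in topological_group) compactin_mult_inv:
  assumes "compactin T A" and "compactin T B"
  shows "compactin T ((\<lambda>(x, y). x \<otimes> inv y) ` (A \<times> B))"
  using assms by (intro image_compactin[OF _ continuous_map_mult_inv]) (simp add: compactin_Times)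

text \<open>A point \<open>c\<close> lies in the translate of an open identity neighborhood \<open>U\<close> by \<open>d\<close> exactly when
  \<open>c d\<inverse> \<in> U\<close>. For fixed \<open>d\<close> this is an open condition on \<open>c\<close>, so the translates form an open
  family. For fixed \<open>c\<close> it is an open condition on \<open>d\<close> that \<open>d = c\<close> satisfies, so some \<open>d\<close> in the
  dense set satisfies it and the family is a cover.\<close>

lemma (in topological_group) compactin_covered_by_translates:
  assumes C: "compactin T C" and U: "openin T U" "\<one> \<in> U"
    and D: "T closure_of D = topspace T" "D \<subseteq> carrier G"
  obtains D' where "finite D'" "D' \<subseteq> D" "\<And>c. c \<in> C \<Longrightarrow> \<exists>d\<in>D'. c \<otimes> inv d \<in> U"
proof -
  define V where "V d = {x \<in> topspace T. x \<otimes> inv d \<in> U}" for d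
  have open_V: "openin T (V d)" if "d \<in> D" for d
  proof -
    have "continuous_map T (prod_topology T T) (\<lambda>x. (x, d))"
      using that D(2) topspace_eq_carrier by (auto simp: continuous_map_paired)
    from continuous_map_compose[OF this continuous_map_mult_inv]
    have "continuous_map T T (\<lambda>x. x \<otimes> inv d)"
      by (simp add: o_def)
    then show ?thesis
      unfolding V_def using U(1) by (rule openin_continuous_map_preimage)
  qed
  have cover: "C \<subseteq> \<Union>(V ` D)"
  proof
    fix c assume "c \<in> C"
    then have c: "c \<in> topspace T"
      using C compactin_subset_topspace by blast
    have "continuous_map T (prod_topology T T) (\<lambda>y. (c, y))"
      using c by (auto simp: continuous_map_paired)
    from continuous_map_compose[OF this continuous_map_mult_inv]
    have "continuous_map T T (\<lambda>y. c \<otimes> inv y)"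
      by (simp add: o_def)
    then have "openin T {y \<in> topspace T. c \<otimes> inv y \<in> U}"
      using U(1) by (rule openin_continuous_map_preimage)
    moreover have "c \<in> {y \<in> topspace T. c \<otimes> inv y \<in> U}"
      using c U(2) topspace_eq_carrier by simp
    moreover have "\<And>S. c \<in> S \<Longrightarrow> openin T S \<Longrightarrow> \<exists>y\<in>D. y \<in> S"
      using c D(1) in_closure_of[of c T D] by auto
    ultimately have "\<exists>y\<in>D. y \<in> {y \<in> topspace T. c \<otimes> inv y \<in> U}"
      by metis
    then obtain d where "d \<in> D" "c \<otimes> inv d \<in> U"
      by blast
    then show "c \<in> \<Union>(V ` D)"
      using c by (auto simp: V_def)
  qed
  have "\<exists>\<F>. finite \<F> \<and> \<F> \<subseteq> V ` D \<and> C \<subseteq> \<Union>\<F>"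
    by (rule compactinD[OF C _ cover]) (use open_V in auto)
  then obtain \<F> where \<F>: "finite \<F>" "\<F> \<subseteq> V ` D" "C \<subseteq> \<Union>\<F>"
    by blast
  obtain D' where D': "D' \<subseteq> D" "finite D'" "\<F> = V ` D'"
    using finite_subset_image[OF \<F>(1,2)] by blast
  show ?thesis
  proof (rule that)
    show "\<exists>d\<in>D'. c \<otimes> inv d \<in> U" if "c \<in> C" for c
      using that \<F>(3) D'(3) by (auto simp: V_def)
  qed (fact D')+
qed

lemma subgroup_DirProd_quotient:
  assumes "group G" and "group H" and \<Gamma>: "subgroup \<Gamma> (G \<times>\<times> H)"
    and x: "(g, h) \<in> \<Gamma>" and y: "(f, d) \<in> \<Gamma>"
  shows "(g \<otimes>\<^bsub>G\<^esub> inv\<^bsub>G\<^esub> f, h \<otimes>\<^bsub>H\<^esub> inv\<^bsub>H\<^esub> d) \<in> \<Gamma>"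
proof -
  have "f \<in> carrier G" "d \<in> carrier H"
    using subgroup.mem_carrier[OF \<Gamma> y] by (auto simp: DirProd_def)
  then have "inv\<^bsub>G \<times>\<times> H\<^esub> (f, d) = (inv\<^bsub>G\<^esub> f, inv\<^bsub>H\<^esub> d)"
    using assms(1,2) by (simp add: inv_DirProd)
  with subgroup.m_closed[OF \<Gamma> x subgroup.m_inv_closed[OF \<Gamma> y]] show ?thesis
    by (simp add: DirProd_def)
qed

text \<open>Finiteness is gained in \<open>H\<close>, by compactness, and transported to \<open>G\<close> by lifting each translating
  element of \<open>snd ` \<Gamma>\<close> to an element of \<open>\<Gamma>\<close>.\<close>

lemma finite_right_translates_of_model_set:
  assumes G: "group G" and H: "topological_group H TH"
    and \<Gamma>: "subgroup \<Gamma> (G \<times>\<times> H)"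
    and dense: "TH closure_of (snd ` \<Gamma>) = topspace TH"
    and W: "\<one>\<^bsub>H\<^esub> \<in> TH interior_of W"
    and C: "compactin TH C"
  obtains F where "finite F" "F \<subseteq> carrier G"
    "\<And>g h. (g, h) \<in> \<Gamma> \<Longrightarrow> h \<in> C \<Longrightarrow> g \<in> fst ` ((carrier G \<times> W) \<inter> \<Gamma>) <#>\<^bsub>G\<^esub> F"
proof -
  interpret G: group G by (rule G)
  interpret H: topological_group H TH by (rule H)
  have \<Gamma>_carrier: "g \<in> carrier G \<and> h \<in> carrier H" if "(g, h) \<in> \<Gamma>" for g h
    using subgroup.mem_carrier[OF \<Gamma> that] by (auto simp: DirProd_def)
  then have "snd ` \<Gamma> \<subseteq> carrier H"
    by auto
  then obtain D where D: "finite D" "D \<subseteq> snd ` \<Gamma>"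
    and cover: "\<And>c. c \<in> C \<Longrightarrow> \<exists>d\<in>D. c \<otimes>\<^bsub>H\<^esub> inv\<^bsub>H\<^esub> d \<in> TH interior_of W"
    using H.compactin_covered_by_translates[OF C openin_interior_of W dense] by blast
  obtain S where S: "S \<subseteq> \<Gamma>" "finite S" "D = snd ` S"
    using finite_subset_image[OF D] by blast
  show thesis
  proof (rule that[of "fst ` S"])
    show "finite (fst ` S)" "fst ` S \<subseteq> carrier G"
      using S \<Gamma>_carrier by auto
    fix g h assume gh: "(g, h) \<in> \<Gamma>" "h \<in> C"
    obtain f d where fd: "(f, d) \<in> S" "h \<otimes>\<^bsub>H\<^esub> inv\<^bsub>H\<^esub> d \<in> W"
      using cover[OF gh(2)] S(3) interior_of_subset[of TH W] by fastforce
    then have "(f, d) \<in> \<Gamma>"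
      using S(1) by blast
    with gh(1) have "(g \<otimes>\<^bsub>G\<^esub> inv\<^bsub>G\<^esub> f, h \<otimes>\<^bsub>H\<^esub> inv\<^bsub>H\<^esub> d) \<in> \<Gamma>"
      by (rule subgroup_DirProd_quotient[OF G H.is_group \<Gamma>])
    then have "g \<otimes>\<^bsub>G\<^esub> inv\<^bsub>G\<^esub> f \<in> fst ` ((carrier G \<times> W) \<inter> \<Gamma>)"
      using fd(2) \<Gamma>_carrier by force
    moreover have "g = g \<otimes>\<^bsub>G\<^esub> inv\<^bsub>G\<^esub> f \<otimes>\<^bsub>G\<^esub> f"
      using \<Gamma>_carrier[OF gh(1)] \<Gamma>_carrier[OF \<open>(f, d) \<in> \<Gamma>\<close>] by (simp add: G.m_assoc)
    ultimately show "g \<in> fst ` ((carrier G \<times> W) \<inter> \<Gamma>) <#>\<^bsub>G\<^esub> fst ` S"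
      using fd(1) unfolding set_mult_def by force
  qed
qed

theorem proposition1p5:
  fixes G :: "('a, 'm) monoid_scheme" and TG :: "'a topology"
    and H :: "('b, 'n) monoid_scheme" and TH :: "'b topology"
    and \<Gamma> :: "('a \<times> 'b) set" and W :: "'b set" and \<Lambda> :: "'a set"
  assumes "topological_group G TG"
    and "topological_group H TH"
    and "discrete_subgroup \<Gamma> (G \<times>\<times> H) (prod_topology TG TH)"
    and "inj_on fst \<Gamma>"
    and "TH closure_of (snd ` \<Gamma>) = topspace TH"
    and "compactin TH W"
    and "set_inv\<^bsub>H\<^esub> W = W"
    and "\<one>\<^bsub>H\<^esub> \<in> TH interior_of W"
    and "\<Lambda> = fst ` ((carrier G \<times> W) \<inter> \<Gamma>)"
  shows "\<forall>I K. compactin TH I \<and> compactin TH K \<longrightarrow>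
    (\<exists>E F. finite E \<and> finite F \<and> E \<subseteq> carrier G \<and> F \<subseteq> carrier G \<and>
      (\<forall>P. P \<subseteq> carrier G \<longrightarrow>
        fst ` ((\<Gamma> <#>\<^bsub>G \<times>\<times> H\<^esub> (P \<times> K)) \<inter> (carrier G \<times> I))
          \<subseteq> (\<Lambda> <#>\<^bsub>G\<^esub> F <#>\<^bsub>G\<^esub> P) \<inter> (E <#>\<^bsub>G\<^esub> \<Lambda> <#>\<^bsub>G\<^esub> P)))"
proof (intro allI impI, elim conjE)
  fix I K assume I: "compactin TH I" and K: "compactin TH K"
  interpret G: topological_group G TG by fact
  interpret H: topological_group H TH by fact
  have \<Gamma>: "subgroup \<Gamma> (G \<times>\<times> H)"
    using assms(3) by (simp add: discrete_subgroup_def)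
  have \<Gamma>_carrier: "g \<in> carrier G \<and> h \<in> carrier H" if "(g, h) \<in> \<Gamma>" for g h
    using subgroup.mem_carrier[OF \<Gamma> that] by (auto simp: DirProd_def)
  have "(\<one>\<^bsub>G\<^esub>, \<one>\<^bsub>H\<^esub>) \<in> \<Gamma>"
    using subgroup.one_closed[OF \<Gamma>] by (simp add: DirProd_def)
  then have inv_\<Gamma>: "(inv\<^bsub>G\<^esub> g, inv\<^bsub>H\<^esub> h) \<in> \<Gamma>" if "(g, h) \<in> \<Gamma>" for g h
    using subgroup_DirProd_quotient[OF G.is_group H.is_group \<Gamma> _ that] \<Gamma>_carrier[OF that]
    by fastforce
  have inv_\<Lambda>: "inv\<^bsub>G\<^esub> l \<in> \<Lambda>" if l: "l \<in> \<Lambda>" for l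
  proof -
    obtain w where w: "(l, w) \<in> \<Gamma>" "w \<in> W"
      using l assms(9) by auto
    then have "inv\<^bsub>H\<^esub> w \<in> W"
      using assms(7) by (auto simp: SET_INV_def)
    then show ?thesis
      using inv_\<Gamma>[OF w(1)] \<Gamma>_carrier assms(9) by force
  qed
  have \<Lambda>_carrier: "\<Lambda> \<subseteq> carrier G"
    using assms(9) by auto
  note translates = finite_right_translates_of_model_set[OF G.is_group assms(2) \<Gamma> assms(5,8),
      folded assms(9)]
  obtain F where F: "finite F" "F \<subseteq> carrier G"
    and F_cover: "\<And>g h. (g, h) \<in> \<Gamma> \<Longrightarrow> h \<in> (\<lambda>(x, y). x \<otimes>\<^bsub>H\<^esub> inv\<^bsub>H\<^esub> y) ` (I \<times> K) \<Longrightarrow> g \<in> \<Lambda> <#>\<^bsub>G\<^esub> F"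
    using translates[OF H.compactin_mult_inv[OF I K]] by blast
  obtain F' where F': "finite F'" "F' \<subseteq> carrier G"
    and F'_cover: "\<And>g h. (g, h) \<in> \<Gamma> \<Longrightarrow> h \<in> (\<lambda>(x, y). x \<otimes>\<^bsub>H\<^esub> inv\<^bsub>H\<^esub> y) ` (K \<times> I) \<Longrightarrow> g \<in> \<Lambda> <#>\<^bsub>G\<^esub> F'"
    using translates[OF H.compactin_mult_inv[OF K I]] by blast
  have mult_P: "g \<otimes>\<^bsub>G\<^esub> p \<in> A <#>\<^bsub>G\<^esub> P" if "g \<in> A" "p \<in> P" for g p A P
    using that by (auto simp: set_mult_def)
  define E where "E = m_inv G ` F'"
  have "fst ` ((\<Gamma> <#>\<^bsub>G \<times>\<times> H\<^esub> (P \<times> K)) \<inter> (carrier G \<times> I))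
          \<subseteq> (\<Lambda> <#>\<^bsub>G\<^esub> F <#>\<^bsub>G\<^esub> P) \<inter> (E <#>\<^bsub>G\<^esub> \<Lambda> <#>\<^bsub>G\<^esub> P)" for P
  proof
    fix x assume "x \<in> fst ` ((\<Gamma> <#>\<^bsub>G \<times>\<times> H\<^esub> (P \<times> K)) \<inter> (carrier G \<times> I))"
    then obtain g h p k where gh: "(g, h) \<in> \<Gamma>" and p: "p \<in> P" and k: "k \<in> K"
      and hk: "h \<otimes>\<^bsub>H\<^esub> k \<in> I" and x: "x = g \<otimes>\<^bsub>G\<^esub> p"
      by (auto simp: set_mult_def DirProd_def)
    have carrier: "g \<in> carrier G" "h \<in> carrier H" "k \<in> carrier H"
      using \<Gamma>_carrier[OF gh] k compactin_subset_topspace[OF K] H.topspace_eq_carrier by auto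
    have "h = (h \<otimes>\<^bsub>H\<^esub> k) \<otimes>\<^bsub>H\<^esub> inv\<^bsub>H\<^esub> k"
      using carrier by (simp add: H.m_assoc)
    then have "g \<in> \<Lambda> <#>\<^bsub>G\<^esub> F"
      using k hk by (intro F_cover[OF gh]) force
    moreover have "g \<in> E <#>\<^bsub>G\<^esub> \<Lambda>"
    proof -
      have "inv\<^bsub>H\<^esub> h = k \<otimes>\<^bsub>H\<^esub> inv\<^bsub>H\<^esub> (h \<otimes>\<^bsub>H\<^esub> k)"
        using carrier by (simp add: H.inv_mult_group flip: H.m_assoc)
      then have "inv\<^bsub>G\<^esub> g \<in> \<Lambda> <#>\<^bsub>G\<^esub> F'"
        using k hk by (intro F'_cover[OF inv_\<Gamma>[OF gh]]) force
      then obtain l f where lf: "l \<in> \<Lambda>" "f \<in> F'" "inv\<^bsub>G\<^esub> g = l \<otimes>\<^bsub>G\<^esub> f"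
        by (auto simp: set_mult_def)
      then have "l \<in> carrier G" "f \<in> carrier G"
        using \<Lambda>_carrier F'(2) by auto
      with lf(3) have "g = inv\<^bsub>G\<^esub> f \<otimes>\<^bsub>G\<^esub> inv\<^bsub>G\<^esub> l"
        using carrier(1) by (metis G.inv_inv G.inv_mult_group)
      moreover have "inv\<^bsub>G\<^esub> f \<in> E"
        using lf(2) by (simp add: E_def)
      ultimately show ?thesis
        using inv_\<Lambda>[OF lf(1)] by (auto simp: set_mult_def)
    qed
    ultimately show "x \<in> (\<Lambda> <#>\<^bsub>G\<^esub> F <#>\<^bsub>G\<^esub> P) \<inter> (E <#>\<^bsub>G\<^esub> \<Lambda> <#>\<^bsub>G\<^esub> P)"
      using mult_P[OF _ p] x by simp
  qed
  moreover have "finite E" "E \<subseteq> carrier G"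
    using F' by (auto simp: E_def)
  ultimately show "\<exists>E F. finite E \<and> finite F \<and> E \<subseteq> carrier G \<and> F \<subseteq> carrier G \<and>
      (\<forall>P. P \<subseteq> carrier G \<longrightarrow>
        fst ` ((\<Gamma> <#>\<^bsub>G \<times>\<times> H\<^esub> (P \<times> K)) \<inter> (carrier G \<times> I))
          \<subseteq> (\<Lambda> <#>\<^bsub>G\<^esub> F <#>\<^bsub>G\<^esub> P) \<inter> (E <#>\<^bsub>G\<^esub> \<Lambda> <#>\<^bsub>G\<^esub> P))"
    using F by (intro exI[of _ E] exI[of _ F] conjI allI impI) assumption+
qed

end
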